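(* Let $\alpha<1/2$ and let $(\lambda_n)_{n\ge3}$ be a sequence of integer arrival rates ($\lambda_n\in\mathbb Z$) such that $\lambda_n\ge0$, $n-\lambda_n\ge1$, $\frac{\log(n-\lambda_n)}{\log n}\in(1/2,1)$ for all $n$, and $$\lim_{n\to\infty}\frac{\log(n-\lambda_n)}{\log n}=1-\alpha .$$ For each $n$, let $\pi_{n,t}$ be the distribution of the number of customers at time $t$ and $\nu_n$ the stationary distribution of the continuous-time $M/M/n$ queue with arrival rate $\lambda_n$ and service rate $1$. Then there exist $\overline D_n>0$ (not depending on $t$ or $\pi_{n,0}$) with $\lim_{n\to\infty}\overline D_n=1$ such that for every $n$ and every initial distribution $\pi_{n,0}$, $$\chi(\pi_{n,t},\nu_n)\le e^{-\overline D_nt}\,\chi(\pi_{n,0},\nu_n)\qquad\forall t\ge0.$$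
   Context: The $M/M/n$ queue with arrival rate $\lambda$ and service rate $1$ is the continuous-time birth-and-death Markov chain on $\mathbb Z_{\ge0}$ (state = number of customers) with birth rate $\lambda$ in every state and death rate $\min\{n,q\}$ in state $q$. For $0<\lambda<n$ it has a unique stationary distribution. For probability distributions $P,Q$ on a countable set $S$ with $P$ absolutely continuous with respect to $Q$, $\chi^2(P,Q)=\sum_{x\in S}\frac{(P(x)-Q(x))^2}{Q(x)}$ and $\chi(P,Q)=\sqrt{\chi^2(P,Q)}\in[0,\infty]$; if $\chi(\pi_{n,0},\nu_n)=\infty$ the bound is vacuous. *)

theory Defs
  imports "HOL-Probability.Probability"
begin

definition birth_death_rate :: "(nat \<Rightarrow> real) \<Rightarrow> (nat \<Rightarrow> real) \<Rightarrow> nat \<Rightarrow> nat \<Rightarrow> real" where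
  "birth_death_rate b d q r =
     (if r = Suc q then b q
      else if q = Suc r then d q
      else if r = q then - (b q + (if q = 0 then 0 else d q))
      else 0)"

definition mmn_rate :: "nat \<Rightarrow> real \<Rightarrow> nat \<Rightarrow> nat \<Rightarrow> real" where
  "mmn_rate n lam = birth_death_rate (\<lambda>_. lam) (\<lambda>q. real (min n q))"

(* P t x is the law at time t >= 0 of the chain started in x; values at t < 0 are irrelevant.
   For a conservative G with bounded rates, such as mmn_rate, these conditions determine
   P on t >= 0 uniquely. *)
definition ctmc_transition :: "('s \<Rightarrow> 's \<Rightarrow> real) \<Rightarrow> (real \<Rightarrow> 's \<Rightarrow> 's pmf) \<Rightarrow> bool" where
  "ctmc_transition G P \<longleftrightarrow>
     (\<forall>x. P 0 x = return_pmf x) \<and>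
     (\<forall>s\<ge>0. \<forall>t\<ge>0. \<forall>x. P (s + t) x = bind_pmf (P s x) (P t)) \<and>
     (\<forall>x y. ((\<lambda>t. pmf (P t x) y) has_real_derivative G x y) (at 0 within {0..}))"

definition law_at :: "(real \<Rightarrow> 's \<Rightarrow> 's pmf) \<Rightarrow> 's pmf \<Rightarrow> real \<Rightarrow> 's pmf" where
  "law_at P p0 t = bind_pmf p0 (P t)"

definition stationary :: "(real \<Rightarrow> 's \<Rightarrow> 's pmf) \<Rightarrow> 's pmf \<Rightarrow> bool" where
  "stationary P nu \<longleftrightarrow> (\<forall>t\<ge>0. law_at P nu t = nu)"

(* The value is infinite when p is not absolutely continuous with respect to q; otherwise
   the points with pmf q x = 0 contribute 0 / 0 = 0. *)
definition chi_square :: "'s::countable pmf \<Rightarrow> 's pmf \<Rightarrow> ennreal" where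
  "chi_square p q =
     (if set_pmf p \<subseteq> set_pmf q
      then \<integral>\<^sup>+x. ennreal ((pmf p x - pmf q x)\<^sup>2 / pmf q x) \<partial>count_space UNIV
      else \<infinity>)"

definition chi :: "'s::countable pmf \<Rightarrow> 's pmf \<Rightarrow> ennreal" where
  "chi p q = (if chi_square p q = \<infinity> then \<infinity> else ennreal (sqrt (enn2real (chi_square p q))))"

(* The remaining lemmas show, by uniformization, that the M/M/n transition function exists. *)

(* poisson_pmf is only specified for a positive rate *)
definition poisson0 :: "real \<Rightarrow> nat pmf" where
  "poisson0 r = (if r = 0 then return_pmf 0 else poisson_pmf r)"

lemma pmf_poisson0 [simp]: "0 \<le> r \<Longrightarrow> pmf (poisson0 r) k = r ^ k / fact k * exp (- r)"
  by (auto simp: poisson0_def pmf_return indicator_def)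

definition uniformized :: "('s \<Rightarrow> 's pmf) \<Rightarrow> real \<Rightarrow> real \<Rightarrow> 's \<Rightarrow> 's pmf" where
  "uniformized J L t x = bind_pmf (poisson0 (L * t)) (\<lambda>k. ((\<lambda>p. bind_pmf p J) ^^ k) (return_pmf x))"

lemma poisson_add:
  assumes "0 \<le> a" "0 \<le> b"
  shows "poisson0 (a + b) = bind_pmf (poisson0 a) (\<lambda>i. map_pmf (\<lambda>j. i + j) (poisson0 b))"
proof (rule pmf_eqI)
  fix k
  have c: "pmf (map_pmf (\<lambda>j. i + j) (poisson0 b)) k = (if i \<le> k then pmf (poisson0 b) (k - i) else 0)" for i
  proof (cases "i \<le> k")
    case True
    have "pmf (map_pmf (\<lambda>j. i + j) (poisson0 b)) (i + (k - i)) = pmf (poisson0 b) (k - i)"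
      by (rule pmf_map_inj') (auto simp: inj_def)
    then show ?thesis using True by simp
  next
    case False
    then show ?thesis by (auto simp: pmf_eq_0_set_pmf)
  qed
  have "pmf (bind_pmf (poisson0 a) (\<lambda>i. map_pmf (\<lambda>j. i + j) (poisson0 b))) k
      = (\<integral>i. (if i \<le> k then pmf (poisson0 b) (k - i) else 0) \<partial>measure_pmf (poisson0 a))"
    by (simp add: pmf_bind c)
  also have "\<dots> = (\<Sum>i\<le>k. (if i \<le> k then pmf (poisson0 b) (k - i) else 0) * pmf (poisson0 a) i)"
    by (rule integral_measure_pmf_real[where A="{..k}"]) (auto split: if_splits)
  also have "\<dots> = (\<Sum>i\<le>k. (a ^ i / fact i * exp (-a)) * (b ^ (k - i) / fact (k - i) * exp (-b)))"
    by (rule sum.cong) (use assms in \<open>auto simp: mult_ac\<close>)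
  also have "\<dots> = (\<Sum>i\<le>k. of_nat (k choose i) * a ^ i * b ^ (k - i)) / fact k * exp (-(a + b))"
    by (auto simp: sum_divide_distrib sum_distrib_right sum_distrib_left binomial_fact exp_add exp_diff exp_minus divide_simps intro!: sum.cong)
  also have "\<dots> = pmf (poisson0 (a + b)) k"
    using assms by (simp add: binomial_ring)
  finally show "pmf (poisson0 (a + b)) k = pmf (bind_pmf (poisson0 a) (\<lambda>i. map_pmf (\<lambda>j. i + j) (poisson0 b))) k" ..
qed

lemma iter_bind:
  fixes p :: "'s pmf" and J :: "'s \<Rightarrow> 's pmf"
  shows "((\<lambda>p. bind_pmf p J) ^^ k) p = bind_pmf p (\<lambda>x. ((\<lambda>p. bind_pmf p J) ^^ k) (return_pmf x))"
proof (induction k)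
  case 0
  then show ?case by (simp add: bind_return_pmf')
next
  case (Suc k)
  show ?case by (simp, subst Suc) (simp add: bind_assoc_pmf)
qed

lemma uniformized_semigroup:
  assumes "0 \<le> s" "0 \<le> t" "0 \<le> L"
  shows "uniformized J L (s + t) x = bind_pmf (uniformized J L s x) (uniformized J L t)"
proof -
  let ?F = "\<lambda>p. bind_pmf p J"
  have "uniformized J L (s + t) x = bind_pmf (poisson0 (L * s)) (\<lambda>i. bind_pmf (poisson0 (L * t)) (\<lambda>j. (?F ^^ (j+i)) (return_pmf x)))"
    unfolding uniformized_def using poisson_add[of "L * s" "L * t"] assms
    by (simp add: distrib_left bind_assoc_pmf map_pmf_def bind_return_pmf add.commute)
  also have "\<dots> = bind_pmf (poisson0 (L * s)) (\<lambda>i. bind_pmf (poisson0 (L * t)) (\<lambda>j. bind_pmf ((?F ^^ i) (return_pmf x)) (\<lambda>y. (?F ^^ j) (return_pmf y))))"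
    by (subst iter_bind[symmetric]) (simp add: funpow_add)
  also have "\<dots> = bind_pmf (uniformized J L s x) (uniformized J L t)"
    unfolding uniformized_def by (subst bind_commute_pmf) (simp add: bind_assoc_pmf)
  finally show ?thesis .
qed

lemma uniformized_deriv:
  assumes "0 \<le> L"
  shows "((\<lambda>t. pmf (uniformized J L t x) y) has_real_derivative L * (pmf (J x) y - pmf (return_pmf x) y)) (at 0 within {0..})"
proof -
  define a where "a k = pmf (((\<lambda>p. bind_pmf p J) ^^ k) (return_pmf x)) y" for k
  define c where "c k = a k * L ^ k / fact k" for k
  have sm: "summable (\<lambda>k. c k * t ^ k)" for t :: real
  proof (rule summable_comparison_test')
    show "summable (\<lambda>k. \<bar>L * t\<bar> ^ k / fact k)"
      using summable_exp_generic[of "\<bar>L * t\<bar>"] by (simp add: field_simps)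
    show "norm (c k * t ^ k) \<le> \<bar>L * t\<bar> ^ k / fact k" if "k \<ge> 0" for k
      using assms pmf_le_1[of "((\<lambda>p. bind_pmf p J) ^^ k) (return_pmf x)" y]
      by (auto simp: c_def a_def abs_mult power_abs power_mult_distrib divide_le_cancel intro!: divide_right_mono mult_right_mono mult_left_le_one_le)
  qed
  have eq: "pmf (uniformized J L t x) y = exp (- (L * t)) * (\<Sum>k. c k * t ^ k)" if t: "t \<ge> 0" for t
  proof -
    have "pmf (uniformized J L t x) y = (\<integral>k. a k \<partial>measure_pmf (poisson0 (L * t)))"
      unfolding uniformized_def pmf_bind a_def ..
    also have "\<dots> = (\<integral>k. pmf (poisson0 (L * t)) k * a k \<partial>count_space UNIV)"
      unfolding measure_pmf_eq_density by (subst integral_density) auto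
    also have "\<dots> = (\<integral>k. exp (- (L * t)) * (c k * t ^ k) \<partial>count_space UNIV)"
      using t assms by (intro Bochner_Integration.integral_cong) (auto simp: c_def power_mult_distrib)
    also have "\<dots> = exp (- (L * t)) * (\<Sum>k. c k * t ^ k)"
    proof -
      have "integrable (count_space UNIV) (\<lambda>k. c k * t ^ k)"
        using sm[of t] t assms by (simp add: integrable_count_space_nat_iff c_def a_def)
      from integral_count_space_nat[OF this] show ?thesis by simp
    qed
    finally show ?thesis .
  qed
  have d: "((\<lambda>t. \<Sum>k. c k * t ^ k) has_real_derivative (\<Sum>k. diffs c k * 0 ^ k)) (at 0)"
    by (rule termdiffs_strong[of c 1]) (use sm[of 1] in auto)
  have "((\<lambda>t. exp (- (L * t)) * (\<Sum>k. c k * t ^ k)) has_real_derivative L * (pmf (J x) y - pmf (return_pmf x) y)) (at 0)"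
    by (rule derivative_eq_intros d refl | simp)+
       (simp add: c_def diffs_def a_def algebra_simps bind_return_pmf)
  from DERIV_subset[OF this subset_UNIV] show ?thesis
    by (rule has_field_derivative_transform_within[where d=1]) (use eq in auto)
qed

lemma ctmc_transition_mmn_exists:
  assumes n: "n > 0" and l: "lam \<ge> 0"
  shows "\<exists>P. ctmc_transition (mmn_rate n lam) P"
proof -
  define L where "L = lam + real n"
  have L: "L > 0" using n l by (simp add: L_def)
  define J where "J q = bind_pmf (bernoulli_pmf (lam / L)) (\<lambda>b. if b then return_pmf (Suc q) else
     map_pmf (\<lambda>c. if c then q - 1 else q) (bernoulli_pmf (real (min n q) / real n)))" for q
  have "L * (pmf (J q) r - pmf (return_pmf q) r) = mmn_rate n lam q r" for q r
  proof -
    have 1: "0 \<le> lam / L" "lam / L \<le> 1" using n l by (auto simp: L_def)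
    have 2: "0 \<le> real (min n q) / real n" "real (min n q) / real n \<le> 1" using n by auto
    have "pmf (J q) r = lam / L * indicator {Suc q} r + (1 - lam / L) * 
      (real (min n q) / real n * indicator {q - 1} r + (1 - real (min n q) / real n) * indicator {q} r)"
      using 1 2 by (auto simp: J_def pmf_bind map_pmf_def pmf_return indicator_def)
    moreover have "L * (1 - lam / L) = n" "L * (lam / L) = lam" using L by (simp_all add: L_def field_simps)
    ultimately have "L * pmf (J q) r = lam * indicator {Suc q} r + real n *
      (real (min n q) / real n * indicator {q - 1} r + (1 - real (min n q) / real n) * indicator {q} r)"
      by (metis (no_types, opaque_lifting) distrib_left mult.assoc)
    also have "\<dots> = lam * indicator {Suc q} r + real (min n q) * indicator {q - 1} r + (real n - real (min n q)) * indicator {q} r"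
      using n by (simp add: field_simps)
    finally show ?thesis
      by (cases q) (auto simp: right_diff_distrib mmn_rate_def birth_death_rate_def indicator_def L_def)
  qed
  with uniformized_deriv[of L J] L have "ctmc_transition (mmn_rate n lam) (uniformized J L)"
    unfolding ctmc_transition_def
    by (auto simp: uniformized_semigroup) (simp_all add: uniformized_def poisson0_def bind_return_pmf)
  then show ?thesis by (intro exI[of _ "uniformized J L"])
qed
end

theory Submission
  imports Defs "HOL-Real_Asymp.Real_Asymp"
begin

text \<open>Write \<open>m = n - \<lambda>\<close> and \<open>r = m (m - 1) / n\<close>; then \<open>r \<rightarrow> \<infinity>\<close>, because \<open>m\<close> is eventually at least \<open>n powr s\<close>
  for some \<open>s > 1/2\<close>. A Chen-type test function, whose successive increments have ratio \<open>1\<close> below \<open>\<lambda>\<close>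
  and \<open>1 + \<eta> (i - \<lambda>) / \<lambda>\<close> between \<open>\<lambda>\<close> and \<open>n\<close>, gives a Poincare inequality with
  constant \<open>min (1 - \<eta>) (\<eta> (1 - \<eta>) r)\<close>, which for \<open>\<eta> = 1 / (1 + r)\<close> is at least \<open>(r / (1 + r))\<^sup>2\<close>.

  To pass from the Poincare inequality to the semigroup without differential equations, note that by
  superadditivity \<open>P\<^sub>h(x,x) \<ge> e\<^sup>-\<^sup>L\<^sup>h\<close> and \<open>P\<^sub>h(x,y) \<ge> h G(x,y) e\<^sup>-\<^sup>L\<^sup>h\<close> for \<open>y \<noteq> x\<close>, uniformly. The law of total variance for the
  stationary law then bounds the loss of variance over a time step \<open>h\<close> from below by
  the Dirichlet form, up to a factor tending to \<open>1\<close>; iterating over steps of size \<open>t / k\<close> and letting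
  \<open>k \<rightarrow> \<infinity>\<close> yields the exponential contraction of variances, hence by duality that of \<open>\<chi>\<close>.\<close>

subsection \<open>Expectations and transition functions\<close>

lemma integrable_pmf_bounded:
  fixes f :: "'a \<Rightarrow> real"
  assumes "\<And>x. \<bar>f x\<bar> \<le> B"
  shows "integrable (measure_pmf p) f"
  using assms by (intro measure_pmf.integrable_const_bound[where B=B]) auto

lemma abs_expectation_le:
  fixes f :: "'a \<Rightarrow> real"
  assumes "\<And>x. \<bar>f x\<bar> \<le> B"
  shows "\<bar>measure_pmf.expectation p f\<bar> \<le> B"
proof -
  have "\<bar>measure_pmf.expectation p f\<bar> \<le> (\<integral>x. \<bar>f x\<bar> \<partial>measure_pmf p)"
    by (rule integral_abs_bound)
  also have "\<dots> \<le> (\<integral>x. B \<partial>measure_pmf p)"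
    using assms by (intro integral_mono integrable_abs integrable_pmf_bounded[OF assms]) auto
  finally show ?thesis by simp
qed

text \<open>Nonnegative integrals already satisfy the tower property. Adding \<open>B\<close> makes
  \<open>f\<close> nonnegative, and the shift cancels at the end.\<close>

lemma expectation_bind_pmf:
  fixes f :: "'b \<Rightarrow> real"
  assumes B: "\<And>x. \<bar>f x\<bar> \<le> B"
  shows "measure_pmf.expectation (bind_pmf p K) f
       = (\<integral>x. measure_pmf.expectation (K x) f \<partial>measure_pmf p)"
proof -
  define g where "g x = f x + B" for x
  have g: "0 \<le> g x" "\<bar>g x\<bar> \<le> 2 * B" for x using B[of x] by (auto simp: g_def)
  have ig: "integrable (measure_pmf q) g" for q by (rule integrable_pmf_bounded[OF g(2)])
  have iK: "integrable (measure_pmf p) (\<lambda>x. measure_pmf.expectation (K x) g)"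
    by (rule integrable_pmf_bounded[OF abs_expectation_le[OF g(2)]])
  have "ennreal (measure_pmf.expectation (bind_pmf p K) g) = (\<integral>\<^sup>+x. g x \<partial>bind_pmf p K)"
    by (intro nn_integral_eq_integral[symmetric] ig) (auto simp: g)
  also have "\<dots> = (\<integral>\<^sup>+x. \<integral>\<^sup>+y. g y \<partial>K x \<partial>p)"
    by simp
  also have "\<dots> = (\<integral>\<^sup>+x. ennreal (measure_pmf.expectation (K x) g) \<partial>p)"
    by (intro nn_integral_cong nn_integral_eq_integral ig) (auto simp: g)
  also have "\<dots> = ennreal (\<integral>x. measure_pmf.expectation (K x) g \<partial>measure_pmf p)"
    by (intro nn_integral_eq_integral iK) (auto simp: g integral_nonneg)
  finally have *: "measure_pmf.expectation (bind_pmf p K) g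
      = (\<integral>x. measure_pmf.expectation (K x) g \<partial>measure_pmf p)"
    by (subst (asm) ennreal_inj) (auto simp: g integral_nonneg)
  have "measure_pmf.expectation q g = measure_pmf.expectation q f + B" for q
    unfolding g_def using integrable_pmf_bounded[of f B q, OF B] by simp
  moreover have "integrable (measure_pmf p) (\<lambda>x. measure_pmf.expectation (K x) f)"
    by (rule integrable_pmf_bounded[OF abs_expectation_le[OF B]])
  ultimately show ?thesis using * by simp
qed

lemma sums_expectation:
  fixes f :: "nat \<Rightarrow> real"
  assumes "\<And>x. \<bar>f x\<bar> \<le> B"
  shows "(\<lambda>i. pmf p i * f i) sums measure_pmf.expectation p f"
proof -
  have "integrable (count_space UNIV) (\<lambda>i. pmf p i * f i)"
    using integrable_pmf_bounded[of f B p, OF assms] unfolding measure_pmf_eq_density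
    by (subst (asm) integrable_density) auto
  from sums_integral_count_space_nat[OF this] show ?thesis
    unfolding measure_pmf_eq_density by (subst integral_density) auto
qed

lemma sums_pmf: "pmf (p :: nat pmf) sums 1"
  using sums_expectation[of "\<lambda>_. 1" 1 p] by simp

text \<open>Keeping finitely many intermediate states only loses mass. With the semigroup property
  this is the superadditivity behind all lower bounds on transition probabilities.\<close>

lemma pmf_bind_ge_sum:
  assumes "finite A"
  shows "(\<Sum>z\<in>A. pmf p z * pmf (K z) y) \<le> pmf (bind_pmf p K) y"
proof -
  have "(\<Sum>z\<in>A. pmf p z * pmf (K z) y) = (\<integral>z. (if z \<in> A then pmf (K z) y else 0) \<partial>measure_pmf p)"
    by (subst integral_measure_pmf_real[OF assms]) (auto intro!: sum.cong split: if_splits)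
  also have "\<dots> \<le> (\<integral>z. pmf (K z) y \<partial>measure_pmf p)"
    by (intro integral_mono integrable_pmf_bounded[of _ 1]) (auto simp: pmf_le_1)
  finally show ?thesis by (simp add: pmf_bind)
qed

lemma tendsto_quotient_at_right_0:
  fixes f :: "real \<Rightarrow> real"
  assumes "(f has_real_derivative D) (at 0 within {0..})"
  shows "((\<lambda>h. (f h - f 0) / h) \<longlongrightarrow> D) (at_right 0)"
proof -
  have "((\<lambda>h. (f h - f 0) / h) \<longlongrightarrow> D) (at 0 within {0..})"
    using assms by (simp add: has_field_derivative_iff)
  then show ?thesis by (rule tendsto_mono[rotated]) (auto intro: at_le)
qed

lemma filterlim_divide_Suc_at_right_0:
  assumes "t > (0::real)"
  shows "filterlim (\<lambda>k. t / real (Suc k)) (at_right 0) sequentially"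
  using assms by real_asymp

section \<open>Lower bounds on transition probabilities\<close>

context
  fixes G :: "'s \<Rightarrow> 's \<Rightarrow> real" and P
  assumes P: "ctmc_transition G P"
begin

lemma ctmc_transition_0: "P 0 x = return_pmf x"
  and ctmc_transition_add: "0 \<le> s \<Longrightarrow> 0 \<le> t \<Longrightarrow> P (s + t) x = bind_pmf (P s x) (P t)"
  and ctmc_transition_deriv: "((\<lambda>t. pmf (P t x) y) has_real_derivative G x y) (at 0 within {0..})"
  using P by (auto simp: ctmc_transition_def)

lemma ctmc_transition_Suc_mult:
  assumes "0 \<le> h"
  shows "P (real (Suc k) * h) x = bind_pmf (P h x) (P (real k * h))"
  using ctmc_transition_add[of h "real k * h" x] assms by (simp add: distrib_right)

text \<open>One way to be at \<open>x\<close> at time \<open>k h\<close> is to be there at each of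
  the times \<open>h\<close>, \<open>2 h\<close>, ..., \<open>k h\<close>.\<close>

lemma pmf_diag_power_le:
  assumes "0 \<le> h"
  shows "pmf (P h x) x ^ k \<le> pmf (P (real k * h) x) x"
proof (induction k)
  case (Suc k)
  have "pmf (P h x) x ^ Suc k \<le> (\<Sum>z\<in>{x}. pmf (P h x) z * pmf (P (real k * h) z) x)"
    using Suc by (simp add: mult_left_mono)
  also have "\<dots> \<le> pmf (P (real (Suc k) * h) x) x"
    unfolding ctmc_transition_Suc_mult[OF assms] by (rule pmf_bind_ge_sum) simp
  finally show ?case .
qed (simp add: ctmc_transition_0)

text \<open>Since \<open>- L\<close> lies strictly below the derivative at 0, a short step
  \<open>h\<close> keeps the chain at \<open>x\<close> with probability at least
  \<open>1 - L * h\<close>. Splitting \<open>t\<close> into ever more equal steps and multiplying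
  gives the exponential.\<close>

lemma pmf_diag_ge_exp:
  assumes L: "- L < G x x" and t: "0 \<le> t"
  shows "exp (- (L * t)) \<le> pmf (P t x) x"
proof (cases "t = 0")
  case False
  with t have t: "t > 0" by simp
  have "((\<lambda>h. (pmf (P h x) x - 1) / h) \<longlongrightarrow> G x x) (at_right 0)"
    using tendsto_quotient_at_right_0[OF ctmc_transition_deriv[of x x]]
    by (simp add: ctmc_transition_0)
  then have "\<forall>\<^sub>F h in at_right 0. - L < (pmf (P h x) x - 1) / h"
    using L by (rule order_tendstoD)
  with eventually_at_right_less have "\<forall>\<^sub>F h in at_right 0. 1 - L * h \<le> pmf (P h x) x"
    by eventually_elim (auto simp: field_simps)
  moreover have "\<forall>\<^sub>F h in at_right 0. L * h < 1"
    by (rule order_tendstoD) (auto intro!: tendsto_eq_intros)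
  ultimately have "\<forall>\<^sub>F h in at_right 0. 0 \<le> 1 - L * h \<and> 1 - L * h \<le> pmf (P h x) x"
    by eventually_elim auto
  then have ev: "\<forall>\<^sub>F k in sequentially. 0 \<le> 1 - L * (t / real (Suc k))
      \<and> 1 - L * (t / real (Suc k)) \<le> pmf (P (t / real (Suc k)) x) x"
    using filterlim_divide_Suc_at_right_0[OF t] by (auto simp: filterlim_iff)
  have "(\<lambda>k. (1 + (- (L * t)) / real (Suc k)) ^ Suc k) \<longlonglongrightarrow> exp (- (L * t))"
    using LIMSEQ_Suc[OF tendsto_exp_limit_sequentially[of "- (L * t)"]] by simp
  then show ?thesis
  proof (rule tendsto_upperbound)
    show "\<forall>\<^sub>F k in sequentially. (1 + (- (L * t)) / real (Suc k)) ^ Suc k \<le> pmf (P t x) x"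
      using ev
    proof eventually_elim
      case (elim k)
      then have "(1 + (- (L * t)) / real (Suc k)) ^ Suc k \<le> pmf (P (t / real (Suc k)) x) x ^ Suc k"
        by (intro power_mono) (auto simp del: of_nat_Suc)
      also have "\<dots> \<le> pmf (P t x) x"
        using pmf_diag_power_le[of "t / real (Suc k)" x "Suc k"] t by (simp del: of_nat_Suc power_Suc)
      finally show ?case .
    qed
  qed simp
qed (simp add: ctmc_transition_0)

text \<open>The factor \<open>k\<close> counts which of the \<open>k\<close> steps makes the jump
  from \<open>x\<close> to \<open>y\<close>; the exponential pays for resting at \<open>x\<close>
  before and at \<open>y\<close> after it. In the induction only the states \<open>x\<close> and
  \<open>y\<close> are kept after the first step.\<close>

lemma pmf_offdiag_mult_le:
  assumes L: "\<And>x. - L < G x x" and h: "0 \<le> h" and xy: "x \<noteq> y"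
  shows "real k * pmf (P h x) y * exp (- (L * (real k * h))) \<le> pmf (P (real k * h) x) y"
proof (induction k)
  case (Suc k)
  have e: "exp (- (L * (real (Suc k) * h))) = exp (- (L * h)) * exp (- (L * (real k * h)))"
    by (simp add: algebra_simps flip: exp_add)
  have "real (Suc k) * pmf (P h x) y * exp (- (L * (real (Suc k) * h)))
      = exp (- (L * h)) * (real k * pmf (P h x) y * exp (- (L * (real k * h))))
        + pmf (P h x) y * exp (- (L * h)) * exp (- (L * (real k * h)))"
    unfolding e by (simp add: algebra_simps)
  also have "\<dots> \<le> pmf (P h x) x * pmf (P (real k * h) x) y + pmf (P h x) y * pmf (P (real k * h) y) y"
  proof (rule add_mono)
    show "exp (- (L * h)) * (real k * pmf (P h x) y * exp (- (L * (real k * h))))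
        \<le> pmf (P h x) x * pmf (P (real k * h) x) y"
      using Suc h by (intro mult_mono pmf_diag_ge_exp L) auto
    have "exp (- (L * h)) \<le> 1"
      using pmf_diag_ge_exp[OF L h, of x] pmf_le_1[of "P h x" x] by linarith
    then have "exp (- (L * h)) * exp (- (L * (real k * h))) \<le> 1 * pmf (P (real k * h) y) y"
      using h by (intro mult_mono pmf_diag_ge_exp L) auto
    then show "pmf (P h x) y * exp (- (L * h)) * exp (- (L * (real k * h)))
        \<le> pmf (P h x) y * pmf (P (real k * h) y) y"
      by (simp add: mult.assoc mult_left_mono)
  qed
  also have "\<dots> = (\<Sum>z\<in>{x, y}. pmf (P h x) z * pmf (P (real k * h) z) y)"
    using xy by simp
  also have "\<dots> \<le> pmf (P (real (Suc k) * h) x) y"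
    unfolding ctmc_transition_Suc_mult[OF h] by (rule pmf_bind_ge_sum) simp
  finally show ?case .
qed (simp)

text \<open>In the limit of steps \<open>h = t / k\<close>, the number \<open>k\<close> times the
  probability of a jump within one step tends to \<open>t * G x y\<close>.\<close>

lemma pmf_offdiag_ge:
  assumes L: "\<And>x. - L < G x x" and t: "0 \<le> t" and xy: "x \<noteq> y"
  shows "t * G x y * exp (- (L * t)) \<le> pmf (P t x) y"
proof (cases "t = 0")
  case False
  with t have t: "t > 0" by simp
  have "((\<lambda>h. pmf (P h x) y / h) \<longlongrightarrow> G x y) (at_right 0)"
    using tendsto_quotient_at_right_0[OF ctmc_transition_deriv[of x y]] xy
    by (simp add: ctmc_transition_0)
  then have "(\<lambda>k. pmf (P (t / real (Suc k)) x) y / (t / real (Suc k))) \<longlonglongrightarrow> G x y"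
    using filterlim_divide_Suc_at_right_0[OF t] by (rule filterlim_compose)
  then have "(\<lambda>k. t * (pmf (P (t / real (Suc k)) x) y / (t / real (Suc k))) * exp (- (L * t)))
      \<longlonglongrightarrow> t * G x y * exp (- (L * t))"
    by (intro tendsto_intros)
  then show ?thesis
  proof (rule tendsto_upperbound)
    show "\<forall>\<^sub>F k in sequentially. t * (pmf (P (t / real (Suc k)) x) y / (t / real (Suc k))) * exp (- (L * t))
        \<le> pmf (P t x) y"
    proof (intro always_eventually allI)
      fix k
      show "t * (pmf (P (t / real (Suc k)) x) y / (t / real (Suc k))) * exp (- (L * t)) \<le> pmf (P t x) y"
        using pmf_offdiag_mult_le[of L "t / real (Suc k)" x y "Suc k"] L xy t
        by (simp del: of_nat_Suc add: mult_ac)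
    qed
  qed simp
qed simp

text \<open>At time 0 the finite sum of \<open>pmf nu x * pmf (P t x) y\<close> equals
  \<open>pmf nu y\<close>, because \<open>y \<in> A\<close>; by stationarity it never exceeds this
  value, so its right derivative at 0 is nonpositive. The finite \<open>A\<close> avoids
  differentiating an infinite sum.\<close>

lemma stationary_balance_le:
  assumes nu: "stationary P nu" and A: "finite A" "y \<in> A"
  shows "(\<Sum>x\<in>A. pmf nu x * G x y) \<le> 0"
proof -
  have "((\<lambda>t. \<Sum>x\<in>A. pmf nu x * pmf (P t x) y) has_real_derivative (\<Sum>x\<in>A. pmf nu x * G x y)) (at 0 within {0..})"
    by (intro DERIV_sum DERIV_cmult ctmc_transition_deriv)
  note * = tendsto_quotient_at_right_0[OF this]
  have 0: "(\<Sum>x\<in>A. pmf nu x * pmf (P 0 x) y) = pmf nu y"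
    using A by (simp add: ctmc_transition_0 pmf_return indicator_def if_distrib sum.delta' cong: if_cong)
  have "\<forall>\<^sub>F h in at_right 0. ((\<Sum>x\<in>A. pmf nu x * pmf (P h x) y) - (\<Sum>x\<in>A. pmf nu x * pmf (P 0 x) y)) / h \<le> 0"
    using eventually_at_right_less
  proof eventually_elim
    case (elim h)
    have "(\<Sum>x\<in>A. pmf nu x * pmf (P h x) y) \<le> pmf (bind_pmf nu (P h)) y"
      by (rule pmf_bind_ge_sum[OF A(1)])
    also have "bind_pmf nu (P h) = nu"
      using nu elim by (auto simp: stationary_def law_at_def)
    finally show ?case using elim unfolding 0 by (simp add: divide_nonpos_pos)
  qed
  with * show ?thesis by (intro tendsto_upperbound[OF *]) auto
qed

end

subsection \<open>Poincare inequality for birth-and-death chains\<close>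

lemma abs_square_le:
  fixes x :: real
  assumes "\<bar>x\<bar> \<le> B"
  shows "\<bar>x\<^sup>2\<bar> \<le> B\<^sup>2"
  using power_mono[OF assms, of 2] by simp

text \<open>The variance is half the sum of \<open>pmf p i * pmf p j * (f i - f j)\<^sup>2\<close>
  over all ordered pairs; only the pairs joining \<open>x\<close> to \<open>y\<close> and to
  \<open>z\<close> are kept.\<close>

lemma three_point_variance:
  fixes f :: "'a \<Rightarrow> real"
  assumes f: "\<And>x. \<bar>f x\<bar> \<le> B" and xyz: "x \<noteq> y" "x \<noteq> z" "y \<noteq> z"
  shows "pmf p x * (pmf p y * (f y - f x)\<^sup>2 + pmf p z * (f z - f x)\<^sup>2)
       \<le> measure_pmf.expectation p (\<lambda>x. (f x)\<^sup>2) - (measure_pmf.expectation p f)\<^sup>2"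
proof -
  define m where "m = measure_pmf.expectation p f"
  define A where "A = f x - m"
  define B' where "B' = f y - m"
  define C where "C = f z - m"
  define u v w where "u = pmf p x" and "v = pmf p y" and "w = pmf p z"
  have if2: "integrable (measure_pmf p) (\<lambda>x. (f x)\<^sup>2)"
    by (rule integrable_pmf_bounded[OF abs_square_le[OF f]])
  have fm: "\<bar>f x - m\<bar> \<le> B + \<bar>m\<bar>" for x using f[of x] by linarith
  have ifm: "integrable (measure_pmf p) (\<lambda>x. (f x - m)\<^sup>2)"
    by (rule integrable_pmf_bounded[OF abs_square_le[OF fm]])
  have "sum (pmf p) {x, y, z} \<le> 1"
    by (subst measure_measure_pmf_finite[symmetric]) auto
  then have s: "u + v + w \<le> 1" using xyz by (simp add: u_def v_def w_def)
  have nn: "0 \<le> u" "0 \<le> v" "0 \<le> w" by (auto simp: u_def v_def w_def)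
  \<comment> \<open>Lagrange's identity for three weights of total mass at most 1. The subtracted
    bracket collects the missing mass, the square of the partial mean and the pair \<open>y\<close>,
    \<open>z\<close>.\<close>
  have "u * (v * (B' - A)\<^sup>2 + w * (C - A)\<^sup>2)
      = (u * A\<^sup>2 + v * B'\<^sup>2 + w * C\<^sup>2)
        - (u * (1 - (u + v + w)) * A\<^sup>2 + (1 - (u + v + w)) * (v * B'\<^sup>2 + w * C\<^sup>2)
           + (u * A + v * B' + w * C)\<^sup>2 + v * w * (B' - C)\<^sup>2)"
    by algebra
  also have "\<dots> \<le> u * A\<^sup>2 + v * B'\<^sup>2 + w * C\<^sup>2"
  proof -
    have "0 \<le> u * (1 - (u + v + w)) * A\<^sup>2 + (1 - (u + v + w)) * (v * B'\<^sup>2 + w * C\<^sup>2)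
           + (u * A + v * B' + w * C)\<^sup>2 + v * w * (B' - C)\<^sup>2"
      using s nn by (intro add_nonneg_nonneg mult_nonneg_nonneg) auto
    then show ?thesis by linarith
  qed
  also have "\<dots> = (\<integral>i. (if i \<in> {x, y, z} then (f i - m)\<^sup>2 else 0) \<partial>measure_pmf p)"
    using xyz
    by (subst integral_measure_pmf_real[of "{x, y, z}"])
       (auto split: if_splits simp: A_def B'_def C_def u_def v_def w_def)
  also have "\<dots> \<le> (\<integral>i. (f i - m)\<^sup>2 \<partial>measure_pmf p)"
    by (intro integral_mono_AE integrable_real_mult_indicator ifm) 
       (auto intro: Bochner_Integration.integrable_bound[OF ifm])
  also have "\<dots> = (\<integral>i. (f i)\<^sup>2 - 2 * m * f i + m\<^sup>2 \<partial>measure_pmf p)"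
    by (simp add: power2_diff algebra_simps)
  also have "\<dots> = measure_pmf.expectation p (\<lambda>x. (f x)\<^sup>2) - m\<^sup>2"
    using if2 integrable_pmf_bounded[of f B p, OF f] by (simp add: m_def power2_eq_square)
  finally show ?thesis by (simp add: A_def B'_def C_def u_def v_def w_def m_def)
qed

text \<open>With \<open>s i\<close> the integral of \<open>g\<close> over \<open>{..i}\<close> one has \<open>\<integral>g\<^sup>2 d\<nu> = - (\<Sum>i. s i * (g (Suc i) - g i))\<close>, so
  Young's inequality reduces the claim to a Hardy inequality for \<open>s\<close>. The latter follows termwise
  from \<open>2xy \<le> c x\<^sup>2 + y\<^sup>2 / c\<close>. If \<open>v i\<close> are the ratios of consecutive increments of a test function,
  then \<open>c (Suc i) = d (Suc i) / (b (Suc i) * v i)\<close> turns the hypothesis on \<open>\<delta>\<close> into Chen's criterion for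
  the spectral gap.\<close>

lemma birth_death_poincare:
  fixes nu :: "nat pmf" and b d c g :: "nat \<Rightarrow> real"
  assumes pos: "\<And>i. 0 < pmf nu i"
    and rev: "\<And>i. pmf nu i * b i = pmf nu (Suc i) * d (Suc i)"
    and b: "\<And>i. 0 < b i" "\<And>i. b i \<le> R"
    and c: "c 0 = 0" "\<And>i. 0 < c (Suc i)" "\<And>i. c i \<le> K"
    and \<delta>: "0 < \<delta>" "\<And>i. \<delta> \<le> b i * (1 - c i) + d (Suc i) * (1 - 1 / c (Suc i))"
    and tail: "0 \<le> \<rho>" "\<rho> < 1" "\<And>i. N0 \<le> i \<Longrightarrow> pmf nu (Suc i) \<le> \<rho> * pmf nu i"
    and g: "\<And>i. \<bar>g i\<bar> \<le> B" "measure_pmf.expectation nu g = 0"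
  shows "\<delta> * measure_pmf.expectation nu (\<lambda>i. (g i)\<^sup>2)
       \<le> measure_pmf.expectation nu (\<lambda>i. b i * (g (Suc i) - g i)\<^sup>2)"
proof -
  define s where "s i = (\<Sum>j\<le>i. pmf nu j * g j)" for i
  define V where "V N = (\<Sum>i\<le>N. pmf nu i * (g i)\<^sup>2)" for N
  define a where "a i = pmf nu i * b i" for i
  define E where "E N = (\<Sum>i<N. a i * (g (Suc i) - g i)\<^sup>2)" for N
  have a: "0 < a i" for i using pos b by (simp add: a_def)
  have s_Suc: "s (Suc i) = s i + pmf nu (Suc i) * g (Suc i)" for i by (simp add: s_def)

  \<comment> \<open>The boundary term makes the induction telescope. For \<open>N = 0\<close> both
    sides vanish, because \<open>c 0 = 0\<close> and \<open>s 0 = pmf nu 0 * g 0\<close>.\<close>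
  have hardy: "\<delta> * (\<Sum>i<N. (s i)\<^sup>2 / a i) \<le> V N + (s N)\<^sup>2 * (c N - 1) / pmf nu N" for N
  proof (induction N)
    case 0
    show ?case using pos[of 0] by (simp add: V_def s_def c power2_eq_square)
  next
    case (Suc N)
    define x y c' where "x = s N" and "y = s (Suc N)" and "c' = c (Suc N)"
    have c': "c' > 0" using c by (simp add: c'_def)
    have "\<delta> / a N \<le> (b N * (1 - c N) + d (Suc N) * (1 - 1 / c')) / a N"
      using \<delta>(2)[of N] a[of N] by (auto simp: c'_def divide_le_cancel)
    also have "\<dots> = b N / a N * (1 - c N) + d (Suc N) / a N * (1 - 1 / c')"
      by (simp add: add_divide_distrib)
    also have "b N / a N = 1 / pmf nu N"
      using pos[of N] b(1)[of N] by (simp add: a_def)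
    also have "d (Suc N) / a N = 1 / pmf nu (Suc N)"
      using pos[of "Suc N"] a[of N] rev[of N] by (auto simp: a_def field_simps)
    finally have "x\<^sup>2 * (\<delta> / a N) \<le> x\<^sup>2 * (1 / pmf nu N * (1 - c N) + 1 / pmf nu (Suc N) * (1 - 1 / c'))"
      by (rule mult_left_mono) simp
    then have 1: "\<delta> * (x\<^sup>2 / a N) + x\<^sup>2 * (c N - 1) / pmf nu N \<le> x\<^sup>2 * (1 - 1 / c') / pmf nu (Suc N)"
      by (simp add: algebra_simps diff_divide_distrib)
    \<comment> \<open>Completing the square with weight \<open>c'\<close>. As
      \<open>y - x = pmf nu (Suc N) * g (Suc N)\<close>, the term \<open>(y - x)\<^sup>2\<close>,
      divided by \<open>pmf nu (Suc N)\<close>, is the new summand of \<open>V\<close>.\<close>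
    have "(y - x)\<^sup>2 + y\<^sup>2 * (c' - 1) - x\<^sup>2 * (1 - 1 / c') = (c' * y - x)\<^sup>2 / c'"
      using c' by (simp add: field_simps power2_eq_square)
    also have "\<dots> \<ge> 0" using c' by simp
    finally have "x\<^sup>2 * (1 - 1 / c') \<le> (y - x)\<^sup>2 + y\<^sup>2 * (c' - 1)" by simp
    then have "x\<^sup>2 * (1 - 1 / c') / pmf nu (Suc N) \<le> ((y - x)\<^sup>2 + y\<^sup>2 * (c' - 1)) / pmf nu (Suc N)"
      using pos[of "Suc N"] by (intro divide_right_mono) auto
    also have "\<dots> = pmf nu (Suc N) * (g (Suc N))\<^sup>2 + y\<^sup>2 * (c' - 1) / pmf nu (Suc N)"
      using pos[of "Suc N"] by (simp add: add_divide_distrib y_def x_def s_Suc power2_eq_square)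
    finally show ?case
      using Suc 1 by (simp add: V_def algebra_simps x_def y_def c'_def)
  qed

  have abel: "V N = g N * s N - (\<Sum>i<N. s i * (g (Suc i) - g i))" for N
  proof (induction N)
    case (Suc N)
    then show ?case by (simp add: V_def s_Suc algebra_simps power2_eq_square)
  qed (simp add: V_def s_def power2_eq_square)

  have young: "- (x * y) \<le> (\<delta> * (x\<^sup>2 / a i) + a i * y\<^sup>2 / \<delta>) / 2" for x y i
  proof -
    have "\<delta> * (x\<^sup>2 / a i) + a i * y\<^sup>2 / \<delta> + 2 * (x * y) = (\<delta> * x + a i * y)\<^sup>2 / (\<delta> * a i)"
      using \<delta>(1) a[of i] by (simp add: field_simps power2_eq_square)
    also have "\<dots> \<ge> 0" using \<delta>(1) a[of i] by simp
    finally show ?thesis by simp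
  qed

  \<comment> \<open>Young's inequality leaves half of the Hardy sum on the right;
    \<open>hardy\<close> bounds it by half of \<open>V N\<close> plus boundary terms, and that half
    is absorbed on the left.\<close>
  have fin: "V N \<le> 2 * (g N * s N) + (s N)\<^sup>2 * (c N - 1) / pmf nu N + E N / \<delta>" for N
  proof -
    have "- (\<Sum>i<N. s i * (g (Suc i) - g i))
        \<le> (\<Sum>i<N. (\<delta> * ((s i)\<^sup>2 / a i) + a i * (g (Suc i) - g i)\<^sup>2 / \<delta>) / 2)"
      unfolding sum_negf[symmetric] by (intro sum_mono young)
    also have "\<dots> = (\<delta> * (\<Sum>i<N. (s i)\<^sup>2 / a i) + E N / \<delta>) / 2"
      by (simp add: E_def sum.distrib add_divide_distrib sum_divide_distrib sum_distrib_left)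
    finally show ?thesis using hardy[of N] abel[of N] by simp
  qed

  define C where "C = B / (1 - \<rho>)"
  have B0: "0 \<le> B" using g(1)[of 0] by linarith
  then have C0: "0 \<le> C" using tail by (simp add: C_def)
  \<comment> \<open>Since \<open>g\<close> has mean zero, \<open>s N\<close> is minus the tail sum
    beyond \<open>N\<close>, and the geometric decay bounds this tail by a multiple of
    \<open>pmf nu N\<close>. Hence the boundary terms in \<open>fin\<close> vanish in the
    limit.\<close>
  have s_bound: "\<bar>s N\<bar> \<le> C * pmf nu N" if N: "N0 \<le> N" for N
  proof -
    have geo: "pmf nu (N + k) \<le> \<rho> ^ k * pmf nu N" for k
    proof (induction k)
      case (Suc k)
      have "pmf nu (N + Suc k) \<le> \<rho> * pmf nu (N + k)" using tail(3)[of "N + k"] N by simp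
      also have "\<dots> \<le> \<rho> * (\<rho> ^ k * pmf nu N)" using Suc tail by (intro mult_left_mono) auto
      finally show ?case by simp
    qed simp
    have "(\<lambda>i. pmf nu i * g i) sums 0" using sums_expectation[of g B nu, OF g(1)] g(2) by simp
    then have 1: "(\<lambda>k. pmf nu (k + Suc N) * g (k + Suc N)) sums (0 - s N)"
      unfolding s_def lessThan_Suc_atMost[symmetric] by (rule sums_split_initial_segment)
    have 2: "(\<lambda>k. \<rho> ^ k * (B * pmf nu N)) sums (1 / (1 - \<rho>) * (B * pmf nu N))"
      using tail by (intro sums_mult2 geometric_sums) auto
    have 3: "\<bar>pmf nu (k + Suc N) * g (k + Suc N)\<bar> \<le> \<rho> ^ k * (B * pmf nu N)" for k
    proof -
      have "pmf nu (k + Suc N) \<le> \<rho> * pmf nu (N + k)" using tail(3)[of "N + k"] N by (simp add: add.commute)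
      also have "\<dots> \<le> 1 * pmf nu (N + k)" using tail by (intro mult_right_mono) auto
      also have "\<dots> \<le> \<rho> ^ k * pmf nu N" using geo by simp
      finally have "pmf nu (k + Suc N) * \<bar>g (k + Suc N)\<bar> \<le> \<rho> ^ k * pmf nu N * B"
        using tail g(1) by (intro mult_mono) auto
      then show ?thesis by (simp add: abs_mult mult_ac)
    qed
    have "- s N \<le> C * pmf nu N"
      using sums_le[OF _ 1 2] 3 abs_le_D1 by (simp add: C_def) blast
    moreover have "s N \<le> C * pmf nu N"
      using sums_le[OF _ sums_minus[OF 1] 2] 3 abs_le_D2 by (simp add: C_def) blast
    ultimately show ?thesis by simp
  qed

  have V_le: "\<forall>\<^sub>F N in sequentially. V N \<le> 2 * B * C * pmf nu N + C\<^sup>2 * K * pmf nu N + E N / \<delta>"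
    using eventually_ge_at_top[of N0]
  proof eventually_elim
    case (elim N)
    note sb = s_bound[OF elim]
    have K: "0 \<le> K" using c(1) c(3)[of 0] by simp
    have "g N * s N \<le> \<bar>g N\<bar> * \<bar>s N\<bar>" by (metis abs_ge_self abs_mult)
    also have "\<dots> \<le> B * (C * pmf nu N)" using g(1) sb B0 by (intro mult_mono) auto
    finally have 1: "g N * s N \<le> B * (C * pmf nu N)" .
    have "(s N)\<^sup>2 * (c N - 1) \<le> (C * pmf nu N)\<^sup>2 * K"
    proof -
      have "(s N)\<^sup>2 * (c N - 1) \<le> (s N)\<^sup>2 * K" using c(3)[of N] by (intro mult_left_mono) auto
      also have "\<dots> \<le> (C * pmf nu N)\<^sup>2 * K"
        using sb K C0 by (intro mult_right_mono) (auto simp: abs_le_square_iff[symmetric])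
      finally show ?thesis .
    qed
    then have "(s N)\<^sup>2 * (c N - 1) / pmf nu N \<le> (C * pmf nu N)\<^sup>2 * K / pmf nu N"
      using pos[of N] by (intro divide_right_mono) auto
    also have "\<dots> = C\<^sup>2 * K * pmf nu N" using pos[of N] by (simp add: power2_eq_square)
    finally show ?case using fin[of N] 1 by simp
  qed
  have V_lim: "V \<longlonglongrightarrow> measure_pmf.expectation nu (\<lambda>i. (g i)\<^sup>2)"
  proof -
    have "(\<lambda>i. pmf nu i * (g i)\<^sup>2) sums measure_pmf.expectation nu (\<lambda>i. (g i)\<^sup>2)"
      by (rule sums_expectation[OF abs_square_le[OF g(1)]])
    then show ?thesis unfolding V_def[abs_def] sums_def_le .
  qed
  have E_lim: "E \<longlonglongrightarrow> measure_pmf.expectation nu (\<lambda>i. b i * (g (Suc i) - g i)\<^sup>2)"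
  proof -
    have "\<bar>b i * (g (Suc i) - g i)\<^sup>2\<bar> \<le> R * (2 * B)\<^sup>2" for i
    proof -
      have "\<bar>g (Suc i) - g i\<bar> \<le> \<bar>2 * B\<bar>" using g(1)[of i] g(1)[of "Suc i"] by linarith
      then have "(g (Suc i) - g i)\<^sup>2 \<le> (2 * B)\<^sup>2" by (simp only: abs_le_square_iff)
      then show ?thesis using b[of i] by (simp add: abs_mult mult_mono del: power_mult_distrib)
    qed
    from sums_expectation[of "\<lambda>i. b i * (g (Suc i) - g i)\<^sup>2", OF this, of nu]
    show ?thesis unfolding E_def[abs_def] a_def sums_def by (simp add: mult.assoc)
  qed
  have nu_lim: "pmf nu \<longlonglongrightarrow> 0"
    using sums_pmf sums_summable summable_LIMSEQ_zero by blast
  have "(\<lambda>N. 2 * B * C * pmf nu N + C\<^sup>2 * K * pmf nu N + E N / \<delta>) \<longlonglongrightarrow> 2 * B * C * 0 + C\<^sup>2 * K * 0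
      + measure_pmf.expectation nu (\<lambda>i. b i * (g (Suc i) - g i)\<^sup>2) / \<delta>"
    using \<delta>(1) by (intro tendsto_intros nu_lim E_lim) auto
  from tendsto_le[OF _ this V_lim V_le]
  have "measure_pmf.expectation nu (\<lambda>i. (g i)\<^sup>2)
      \<le> measure_pmf.expectation nu (\<lambda>i. b i * (g (Suc i) - g i)\<^sup>2) / \<delta>" by simp
  then show ?thesis using \<delta>(1) by (simp add: field_simps)
qed

subsection \<open>Contraction of the variance and of the chi distance\<close>

context
  fixes b d :: "nat \<Rightarrow> real" and P and nu :: "nat pmf" and R L :: real
  assumes P: "ctmc_transition (birth_death_rate b d) P" and nu: "stationary P nu"
    and b: "\<And>i. 0 \<le> b i" "\<And>i. b i \<le> R" and d: "\<And>i. 0 \<le> d i" "\<And>i. d i \<le> R"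
    and rev: "\<And>i. pmf nu i * b i = pmf nu (Suc i) * d (Suc i)"
    and L: "\<And>i. - L < birth_death_rate b d i i"
begin

lemma expectation_transition_invariant:
  fixes f :: "nat \<Rightarrow> real"
  assumes "0 \<le> t" "\<And>x. \<bar>f x\<bar> \<le> B"
  shows "(\<integral>x. measure_pmf.expectation (P t x) f \<partial>nu) = measure_pmf.expectation nu f"
  using expectation_bind_pmf[of f B nu "P t", OF assms(2)] nu assms(1)
  by (simp add: stationary_def law_at_def)

text \<open>This is \<open>three_point_variance\<close> at \<open>x\<close> and its two neighbours.
  One factor \<open>exp (- (L * h))\<close> comes from staying at \<open>x\<close>, the other from
  the jump.\<close>

lemma transition_variance_ge:
  fixes f :: "nat \<Rightarrow> real"
  assumes h: "0 \<le> h" and f: "\<And>x. \<bar>f x\<bar> \<le> B"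
  shows "h * exp (- (2 * L * h)) * (b x * (f (Suc x) - f x)\<^sup>2 + d x * (f x - f (x - 1))\<^sup>2)
       \<le> measure_pmf.expectation (P h x) (\<lambda>x. (f x)\<^sup>2) - (measure_pmf.expectation (P h x) f)\<^sup>2"
proof -
  let ?p = "P h x" and ?e = "exp (- (L * h))"
  \<comment> \<open>State 0 has no lower neighbour: 2 is then a dummy point distinct from 0 and 1,
    and the death term vanishes because \<open>0 - 1 = 0\<close>.\<close>
  define z where "z = (if x = 0 then 2 else x - 1)"
  have e: "exp (- (2 * L * h)) = ?e * ?e" by (simp flip: exp_add)
  have z: "x \<noteq> z" "Suc x \<noteq> z" by (auto simp: z_def)
  have "h * exp (- (2 * L * h)) * (b x * (f (Suc x) - f x)\<^sup>2 + d x * (f x - f (x - 1))\<^sup>2)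
      = ?e * (h * b x * ?e * (f (Suc x) - f x)\<^sup>2 + h * d x * ?e * (f x - f (x - 1))\<^sup>2)"
    unfolding e by (simp add: algebra_simps)
  also have "\<dots> \<le> ?e * (pmf ?p (Suc x) * (f (Suc x) - f x)\<^sup>2 + pmf ?p z * (f z - f x)\<^sup>2)"
  proof (intro mult_left_mono add_mono)
    have "h * birth_death_rate b d x (Suc x) * ?e \<le> pmf ?p (Suc x)"
      by (rule pmf_offdiag_ge[OF P L h]) simp
    then show "h * b x * ?e * (f (Suc x) - f x)\<^sup>2 \<le> pmf ?p (Suc x) * (f (Suc x) - f x)\<^sup>2"
      by (intro mult_right_mono) (auto simp: birth_death_rate_def)
    show "h * d x * ?e * (f x - f (x - 1))\<^sup>2 \<le> pmf ?p z * (f z - f x)\<^sup>2"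
    proof (cases "x = 0")
      case False
      then have "h * birth_death_rate b d x z * ?e \<le> pmf ?p z"
        using z by (intro pmf_offdiag_ge[OF P L h]) simp
      moreover have "birth_death_rate b d x z = d x"
        using False by (auto simp: birth_death_rate_def z_def)
      ultimately show ?thesis
        using False by (auto simp: z_def power2_commute intro!: mult_mono)
    qed simp
  qed simp
  also have "\<dots> \<le> pmf ?p x * (pmf ?p (Suc x) * (f (Suc x) - f x)\<^sup>2 + pmf ?p z * (f z - f x)\<^sup>2)"
    by (intro mult_right_mono pmf_diag_ge_exp[OF P L h]) auto
  also have "\<dots> \<le> measure_pmf.expectation ?p (\<lambda>x. (f x)\<^sup>2) - (measure_pmf.expectation ?p f)\<^sup>2"
    by (rule three_point_variance[OF f]) (use z in auto)
  finally show ?thesis .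
qed

text \<open>Detailed balance moves the contribution of each edge from its upper to its lower end;
  the term at 0 vanishes by truncated subtraction.\<close>

lemma expectation_death_eq_birth:
  fixes f :: "nat \<Rightarrow> real"
  assumes f: "\<And>x. \<bar>f x\<bar> \<le> B"
  shows "measure_pmf.expectation nu (\<lambda>x. d x * (f x - f (x - 1))\<^sup>2)
       = measure_pmf.expectation nu (\<lambda>x. b x * (f (Suc x) - f x)\<^sup>2)"
    and "integrable nu (\<lambda>x. d x * (f x - f (x - 1))\<^sup>2)"
    and "integrable nu (\<lambda>x. b x * (f (Suc x) - f x)\<^sup>2)"
proof -
  have bnd: "\<bar>r * (f x - f y)\<^sup>2\<bar> \<le> R * (2 * B)\<^sup>2" if "0 \<le> r" "r \<le> R" for r x y
  proof -
    have "\<bar>f x - f y\<bar> \<le> 2 * B" using f[of x] f[of y] by linarith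
    from abs_square_le[OF this] that show ?thesis
      by (simp add: abs_mult mult_mono del: power_mult_distrib)
  qed
  note bb = bnd[OF b] and bd = bnd[OF d]
  have "(\<lambda>x. pmf nu (Suc x) * (d (Suc x) * (f (Suc x) - f x)\<^sup>2)) sums
      measure_pmf.expectation nu (\<lambda>x. b x * (f (Suc x) - f x)\<^sup>2)"
    using sums_expectation[of "\<lambda>x. b x * (f (Suc x) - f x)\<^sup>2", OF bb, of nu]
    by (simp add: rev mult.assoc[symmetric])
  then have "(\<lambda>x. pmf nu x * (d x * (f x - f (x - 1))\<^sup>2)) sums
      measure_pmf.expectation nu (\<lambda>x. b x * (f (Suc x) - f x)\<^sup>2)"
    by (subst (asm) sums_Suc_iff[of "\<lambda>x. pmf nu x * (d x * (f x - f (x - 1))\<^sup>2)", simplified]) simp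
  with sums_expectation[of "\<lambda>x. d x * (f x - f (x - 1))\<^sup>2", OF bd, of nu]
  show "measure_pmf.expectation nu (\<lambda>x. d x * (f x - f (x - 1))\<^sup>2)
       = measure_pmf.expectation nu (\<lambda>x. b x * (f (Suc x) - f x)\<^sup>2)"
    by (rule sums_unique2)
  show "integrable nu (\<lambda>x. d x * (f x - f (x - 1))\<^sup>2)"
    by (rule integrable_pmf_bounded[OF bd])
  show "integrable nu (\<lambda>x. b x * (f (Suc x) - f x)\<^sup>2)"
    by (rule integrable_pmf_bounded[OF bb])
qed

text \<open>The pointwise variance bound is integrated against \<open>nu\<close>, and stationarity
  evaluates the mean of the conditional second moments. Births and deaths contribute equally, hence
  the factor 2.\<close>

lemma transition_norm_decrease:
  fixes f :: "nat \<Rightarrow> real"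
  assumes h: "0 \<le> h" and f: "\<And>x. \<bar>f x\<bar> \<le> B"
  shows "(\<integral>x. (measure_pmf.expectation (P h x) f)\<^sup>2 \<partial>nu)
       \<le> measure_pmf.expectation nu (\<lambda>x. (f x)\<^sup>2)
         - 2 * h * exp (- (2 * L * h)) * measure_pmf.expectation nu (\<lambda>x. b x * (f (Suc x) - f x)\<^sup>2)"
proof -
  let ?q = "h * exp (- (2 * L * h))"
  note E = expectation_death_eq_birth[of f B, OF f]
  note f2 = abs_square_le[OF f]
  have T: "integrable nu (\<lambda>x. measure_pmf.expectation (P h x) (\<lambda>x. (f x)\<^sup>2))"
    by (rule integrable_pmf_bounded[OF abs_expectation_le[OF f2]])
  have "(\<integral>x. (measure_pmf.expectation (P h x) f)\<^sup>2 \<partial>nu)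
     \<le> (\<integral>x. measure_pmf.expectation (P h x) (\<lambda>x. (f x)\<^sup>2)
           - ?q * (b x * (f (Suc x) - f x)\<^sup>2 + d x * (f x - f (x - 1))\<^sup>2) \<partial>nu)"
  proof (intro integral_mono)
    show "integrable nu (\<lambda>x. (measure_pmf.expectation (P h x) f)\<^sup>2)"
      by (rule integrable_pmf_bounded[OF abs_square_le[OF abs_expectation_le[OF f]]])
    show "integrable nu (\<lambda>x. measure_pmf.expectation (P h x) (\<lambda>x. (f x)\<^sup>2)
           - ?q * (b x * (f (Suc x) - f x)\<^sup>2 + d x * (f x - f (x - 1))\<^sup>2))"
      by (intro Bochner_Integration.integrable_diff integrable_mult_right Bochner_Integration.integrable_add
            E T)
    show "(measure_pmf.expectation (P h x) f)\<^sup>2 \<le> measure_pmf.expectation (P h x) (\<lambda>x. (f x)\<^sup>2)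
           - ?q * (b x * (f (Suc x) - f x)\<^sup>2 + d x * (f x - f (x - 1))\<^sup>2)" for x
      using transition_variance_ge[of h f B x, OF h f] by linarith
  qed
  also have "\<dots> = (\<integral>x. measure_pmf.expectation (P h x) (\<lambda>x. (f x)\<^sup>2) \<partial>nu)
      - ?q * (measure_pmf.expectation nu (\<lambda>x. b x * (f (Suc x) - f x)\<^sup>2)
              + measure_pmf.expectation nu (\<lambda>x. d x * (f x - f (x - 1))\<^sup>2))"
    using E(2,3) T by simp
  also have "(\<integral>x. measure_pmf.expectation (P h x) (\<lambda>x. (f x)\<^sup>2) \<partial>nu)
      = measure_pmf.expectation nu (\<lambda>x. (f x)\<^sup>2)"
    by (rule expectation_transition_invariant[OF h f2])
  finally show ?thesis unfolding E(1) by (simp add: algebra_simps)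
qed

context
  fixes \<delta> :: real
  assumes poincare: "\<And>g B. (\<And>x. \<bar>g x\<bar> \<le> B) \<Longrightarrow> measure_pmf.expectation nu g = 0 \<Longrightarrow>
      \<delta> * measure_pmf.expectation nu (\<lambda>x. (g x)\<^sup>2)
        \<le> measure_pmf.expectation nu (\<lambda>x. b x * (g (Suc x) - g x)\<^sup>2)"
begin

text \<open>Stationarity preserves mean zero, so the Poincare inequality applies anew at every step.
  The resulting factors \<open>1 + x\<close> are bounded by \<open>exp x\<close>.\<close>

lemma transition_norm_iterate:
  fixes f :: "nat \<Rightarrow> real"
  assumes h: "0 \<le> h" and f: "\<And>x. \<bar>f x\<bar> \<le> B" and f0: "measure_pmf.expectation nu f = 0"
  shows "(\<integral>x. (measure_pmf.expectation (P (real k * h) x) f)\<^sup>2 \<partial>nu)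
       \<le> exp (- (2 * \<delta> * (real k * h) * exp (- (2 * L * h)))) * measure_pmf.expectation nu (\<lambda>x. (f x)\<^sup>2)"
proof (induction k)
  case 0
  show ?case using P by (simp add: ctmc_transition_0)
next
  case (Suc k)
  define F where "F x = measure_pmf.expectation (P (real k * h) x) f" for x
  let ?q = "exp (- (2 * L * h))" and ?M = "measure_pmf.expectation nu (\<lambda>x. (F x)\<^sup>2)"
  have FB: "\<bar>F x\<bar> \<le> B" for x unfolding F_def by (rule abs_expectation_le[OF f])
  have F0: "measure_pmf.expectation nu F = 0"
    unfolding F_def using h f f0 by (subst expectation_transition_invariant) auto
  have "(\<integral>x. (measure_pmf.expectation (P (real (Suc k) * h) x) f)\<^sup>2 \<partial>nu)
      = (\<integral>x. (measure_pmf.expectation (P h x) F)\<^sup>2 \<partial>nu)"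
    unfolding ctmc_transition_Suc_mult[OF P h] F_def by (subst expectation_bind_pmf[OF f]) simp
  also have "\<dots> \<le> ?M - 2 * h * ?q * measure_pmf.expectation nu (\<lambda>x. b x * (F (Suc x) - F x)\<^sup>2)"
    by (rule transition_norm_decrease[OF h FB])
  also have "\<dots> \<le> ?M - 2 * h * ?q * (\<delta> * ?M)"
    using h by (intro diff_left_mono mult_left_mono poincare[OF FB F0]) auto
  also have "\<dots> = (1 + (- (2 * \<delta> * h * ?q))) * ?M"
    by (simp add: algebra_simps)
  also have "\<dots> \<le> exp (- (2 * \<delta> * h * ?q)) * ?M"
    by (intro mult_right_mono exp_ge_add_one_self) (auto intro: integral_nonneg)
  also have "\<dots> \<le> exp (- (2 * \<delta> * h * ?q)) * (exp (- (2 * \<delta> * (real k * h) * ?q)) * measure_pmf.expectation nu (\<lambda>x. (f x)\<^sup>2))"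
    using Suc by (intro mult_left_mono) (auto simp: F_def)
  also have "\<dots> = exp (- (2 * \<delta> * (real (Suc k) * h) * ?q)) * measure_pmf.expectation nu (\<lambda>x. (f x)\<^sup>2)"
    by (simp add: algebra_simps flip: exp_add)
  finally show ?case .
qed

text \<open>With steps \<open>h = t / k\<close> the correction \<open>exp (- (2 * L * h))\<close>
  tends to 1 as \<open>k\<close> grows.\<close>

lemma transition_norm_contraction:
  fixes f :: "nat \<Rightarrow> real"
  assumes t: "0 \<le> t" and f: "\<And>x. \<bar>f x\<bar> \<le> B" and f0: "measure_pmf.expectation nu f = 0"
  shows "(\<integral>x. (measure_pmf.expectation (P t x) f)\<^sup>2 \<partial>nu)
       \<le> exp (- (2 * \<delta> * t)) * measure_pmf.expectation nu (\<lambda>x. (f x)\<^sup>2)"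
proof -
  have "(\<lambda>k. exp (- (2 * \<delta> * t * exp (- (2 * L * (t / real (Suc k)))))) * measure_pmf.expectation nu (\<lambda>x. (f x)\<^sup>2))
     \<longlonglongrightarrow> exp (- (2 * \<delta> * t * exp (- (2 * L * 0)))) * measure_pmf.expectation nu (\<lambda>x. (f x)\<^sup>2)"
  proof (intro tendsto_intros)
    show "(\<lambda>k. t / real (Suc k)) \<longlonglongrightarrow> 0" by real_asymp
  qed
  then have *: "(\<lambda>k. exp (- (2 * \<delta> * t * exp (- (2 * L * (t / real (Suc k)))))) * measure_pmf.expectation nu (\<lambda>x. (f x)\<^sup>2))
     \<longlonglongrightarrow> exp (- (2 * \<delta> * t)) * measure_pmf.expectation nu (\<lambda>x. (f x)\<^sup>2)"
    by simp
  show ?thesis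
  proof (rule tendsto_lowerbound[OF *])
    show "\<forall>\<^sub>F k in sequentially. (\<integral>x. (measure_pmf.expectation (P t x) f)\<^sup>2 \<partial>nu)
        \<le> exp (- (2 * \<delta> * t * exp (- (2 * L * (t / real (Suc k)))))) * measure_pmf.expectation nu (\<lambda>x. (f x)\<^sup>2)"
    proof (intro always_eventually allI)
      fix k
      have "real (Suc k) * (t / real (Suc k)) = t" by simp
      then show "(\<integral>x. (measure_pmf.expectation (P t x) f)\<^sup>2 \<partial>nu)
        \<le> exp (- (2 * \<delta> * t * exp (- (2 * L * (t / real (Suc k)))))) * measure_pmf.expectation nu (\<lambda>x. (f x)\<^sup>2)"
        using transition_norm_iterate[of "t / real (Suc k)" f B "Suc k"] t f f0 by (simp del: of_nat_Suc)
    qed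
  qed simp
qed

end

end

text \<open>By duality it suffices to test \<^term>\<open>law_at P p0 t\<close> against the truncation of its centred density.\<close>

lemma chi_contraction:
  fixes nu :: "nat pmf"
  assumes nu: "stationary P nu" and pos: "\<And>i. 0 < pmf nu i" and t: "0 \<le> t"
    and contr: "\<And>f B. (\<And>x. \<bar>f x\<bar> \<le> B) \<Longrightarrow> measure_pmf.expectation nu f = 0 \<Longrightarrow>
      (\<integral>x. (measure_pmf.expectation (P t x) f)\<^sup>2 \<partial>nu)
        \<le> exp (- (2 * \<delta> * t)) * measure_pmf.expectation nu (\<lambda>x. (f x)\<^sup>2)"
  shows "chi (law_at P p0 t) nu \<le> ennreal (exp (- \<delta> * t)) * chi p0 nu"
proof (cases "chi_square p0 nu = \<infinity>")
  case True
  then show ?thesis by (simp add: chi_def ennreal_mult_eq_top_iff ennreal_mult_top)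
next
  case False
  define a where "a = exp (- (2 * \<delta> * t))"
  define pt where "pt = law_at P p0 t"
  define X where "X = enn2real (chi_square p0 nu)"
  have a: "a > 0" by (simp add: a_def)
  have set_nu: "set_pmf nu = UNIV" using pos by (auto simp: set_pmf_eq less_imp_neq[symmetric])
  have chi2: "chi_square p nu = (\<Sum>i. ennreal ((pmf p i - pmf nu i)\<^sup>2 / pmf nu i))" for p
    by (simp add: chi_square_def set_nu nn_integral_count_space_nat)
  have X: "chi_square p0 nu = ennreal X" using False by (simp add: X_def less_top)
  have X0: "0 \<le> X" by (simp add: X_def)
  have partial_X: "(\<Sum>i<M. (pmf p0 i - pmf nu i)\<^sup>2 / pmf nu i) \<le> X" for M
  proof -
    have "ennreal (\<Sum>i<M. (pmf p0 i - pmf nu i)\<^sup>2 / pmf nu i)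
        = (\<Sum>i<M. ennreal ((pmf p0 i - pmf nu i)\<^sup>2 / pmf nu i))"
      by (subst sum_ennreal) auto
    also have "\<dots> \<le> chi_square p0 nu" unfolding chi2 by (rule sum_le_suminf) auto
    finally show ?thesis unfolding X by (simp add: X0)
  qed
  have Y: "(\<Sum>i<N. (pmf pt i - pmf nu i)\<^sup>2 / pmf nu i) \<le> a * X" for N
  proof -
    define Y where "Y = (\<Sum>i<N. (pmf pt i - pmf nu i)\<^sup>2 / pmf nu i)"
    define f where "f i = (if i < N then (pmf pt i - pmf nu i) / pmf nu i else 0)" for i
    define \<mu> where "\<mu> = measure_pmf.expectation nu f"
    define g where "g i = f i - \<mu>" for i
    define F where "F x = measure_pmf.expectation (P t x) g" for x
    define B where "B = (\<Sum>i<N. \<bar>f i\<bar>)"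
    have f: "\<bar>f i\<bar> \<le> B" for i
    proof (cases "i < N")
      case True
      then show ?thesis unfolding B_def by (intro member_le_sum) auto
    qed (auto simp: f_def B_def sum_nonneg)
    have g: "\<bar>g i\<bar> \<le> B + \<bar>\<mu>\<bar>" for i using f[of i] by (simp add: g_def)
    have intf: "integrable (measure_pmf p) f" for p
      by (rule integrable_pmf_bounded[OF f])
    have intf2: "integrable (measure_pmf nu) (\<lambda>x. (f x)\<^sup>2)"
      by (rule integrable_pmf_bounded[OF abs_square_le[OF f]])
    have Ef: "measure_pmf.expectation p f = (\<Sum>i<N. f i * pmf p i)" for p
      by (rule integral_measure_pmf_real) (auto simp: f_def split: if_splits)
    have Ef2: "measure_pmf.expectation nu (\<lambda>x. (f x)\<^sup>2) = Y"
      unfolding Y_def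
      by (subst integral_measure_pmf_real[of "{..<N}"])
         (auto simp: f_def power2_eq_square less_imp_neq[OF pos, symmetric] split: if_splits intro!: sum.cong)
    have g0: "measure_pmf.expectation nu g = 0"
      unfolding g_def using intf[of nu] by (simp add: \<mu>_def)
    have "measure_pmf.expectation nu (\<lambda>x. (g x)\<^sup>2)
        = (\<integral>x. (f x)\<^sup>2 - 2 * \<mu> * f x + \<mu>\<^sup>2 \<partial>nu)"
      by (simp add: g_def power2_diff algebra_simps)
    also have "\<dots> = Y - 2 * \<mu> * \<mu> + \<mu>\<^sup>2"
      using intf[of nu] intf2 by (simp add: Ef2 \<mu>_def[symmetric])
    also have "\<dots> = Y - \<mu>\<^sup>2" by (simp add: power2_eq_square)
    finally have g2: "measure_pmf.expectation nu (\<lambda>x. (g x)\<^sup>2) \<le> Y" by simp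
    have F2: "measure_pmf.expectation nu (\<lambda>x. (F x)\<^sup>2) \<le> a * Y"
    proof -
      have "measure_pmf.expectation nu (\<lambda>x. (F x)\<^sup>2) \<le> a * measure_pmf.expectation nu (\<lambda>x. (g x)\<^sup>2)"
        unfolding F_def a_def by (rule contr[OF g g0])
      also have "\<dots> \<le> a * Y" using a g2 by (intro mult_left_mono) auto
      finally show ?thesis .
    qed
    have FB: "\<bar>F x\<bar> \<le> B + \<bar>\<mu>\<bar>" for x unfolding F_def by (rule abs_expectation_le[OF g])
    have F0: "measure_pmf.expectation nu F = 0"
      using expectation_bind_pmf[of g _ nu "P t", OF g] nu t g0
      by (simp add: F_def[abs_def] stationary_def law_at_def)
    \<comment> \<open>Besides being the second moment of \<open>f\<close> under \<open>nu\<close>,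
      \<open>Y\<close> is the difference of the means of \<open>f\<close> under \<open>pt\<close>
      and \<open>nu\<close>. In this form the semigroup can be moved from the law onto the test
      function.\<close>
    have "Y = measure_pmf.expectation pt f - \<mu>"
      unfolding \<mu>_def Ef Y_def sum_subtractf[symmetric]
      by (intro sum.cong) (auto simp: f_def power2_eq_square field_simps less_imp_neq[OF pos, symmetric])
    also have "\<dots> = measure_pmf.expectation pt g"
      unfolding g_def using intf[of pt] by simp
    also have "\<dots> = measure_pmf.expectation p0 F"
      unfolding pt_def law_at_def F_def by (rule expectation_bind_pmf[OF g])
    finally have YF: "Y = measure_pmf.expectation p0 F" .
    \<comment> \<open>As \<open>F\<close> has mean zero under \<open>nu\<close>, the law
      \<open>p0\<close> may be replaced by \<open>p0 - nu\<close>, which brings in its chi-square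
      distance.\<close>
    have "(\<lambda>i. pmf p0 i * F i - pmf nu i * F i) sums (Y - 0)"
      unfolding YF F0[symmetric] by (intro sums_diff sums_expectation[OF FB])
    then have lim1: "(\<lambda>M. \<Sum>i<M. pmf p0 i * F i - pmf nu i * F i) \<longlonglongrightarrow> Y" by (simp add: sums_def)
    have "(\<lambda>M. \<Sum>i<M. pmf nu i * (F i)\<^sup>2) \<longlonglongrightarrow> measure_pmf.expectation nu (\<lambda>x. (F x)\<^sup>2)"
      using sums_expectation[of "\<lambda>i. (F i)\<^sup>2", OF abs_square_le[OF FB], of nu] by (simp add: sums_def)
    then have lim2: "(\<lambda>M. (a * X + (\<Sum>i<M. pmf nu i * (F i)\<^sup>2) / a) / 2)
        \<longlonglongrightarrow> (a * X + measure_pmf.expectation nu (\<lambda>x. (F x)\<^sup>2) / a) / 2"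
      using a by (intro tendsto_intros) auto
    \<comment> \<open>Cauchy-Schwarz in the form of Young's inequality. The weight \<open>a\<close>
      is chosen so that by \<open>F2\<close> the second term is at most \<open>Y / 2\<close> in the
      limit, which the left side absorbs.\<close>
    have "(\<Sum>i<M. pmf p0 i * F i - pmf nu i * F i) \<le> (a * X + (\<Sum>i<M. pmf nu i * (F i)\<^sup>2) / a) / 2" for M
    proof -
      have "pmf p0 i * F i - pmf nu i * F i
          \<le> (a * ((pmf p0 i - pmf nu i)\<^sup>2 / pmf nu i) + pmf nu i * (F i)\<^sup>2 / a) / 2" for i
      proof -
        define e v x where "e = pmf p0 i - pmf nu i" and "v = pmf nu i" and "x = F i"
        have v: "v > 0" using pos by (simp add: v_def)
        have "a * (e\<^sup>2 / v) + v * x\<^sup>2 / a - 2 * (e * x) = (a * e - v * x)\<^sup>2 / (a * v)"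
          using a v by (simp add: field_simps power2_eq_square)
        also have "\<dots> \<ge> 0" using a v by simp
        finally show ?thesis by (simp add: e_def v_def x_def algebra_simps)
      qed
      then have "(\<Sum>i<M. pmf p0 i * F i - pmf nu i * F i)
          \<le> (\<Sum>i<M. (a * ((pmf p0 i - pmf nu i)\<^sup>2 / pmf nu i) + pmf nu i * (F i)\<^sup>2 / a) / 2)"
        by (rule sum_mono)
      also have "\<dots> = (a * (\<Sum>i<M. (pmf p0 i - pmf nu i)\<^sup>2 / pmf nu i) + (\<Sum>i<M. pmf nu i * (F i)\<^sup>2) / a) / 2"
        by (simp add: sum.distrib sum_distrib_left sum_divide_distrib[symmetric])
      also have "\<dots> \<le> (a * X + (\<Sum>i<M. pmf nu i * (F i)\<^sup>2) / a) / 2"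
        using partial_X[of M] a by simp
      finally show ?thesis .
    qed
    then have "Y \<le> (a * X + measure_pmf.expectation nu (\<lambda>x. (F x)\<^sup>2) / a) / 2"
      by (intro LIMSEQ_le[OF lim1 lim2]) auto
    also have "\<dots> \<le> (a * X + Y) / 2"
      using F2 a by (simp add: field_simps)
    finally show ?thesis unfolding Y_def by simp
  qed
  have "chi_square pt nu \<le> ennreal (a * X)"
    unfolding chi2
  proof (rule suminf_le_const)
    show "(\<Sum>i<N. ennreal ((pmf pt i - pmf nu i)\<^sup>2 / pmf nu i)) \<le> ennreal (a * X)" for N
      using Y[of N] by (subst sum_ennreal) (auto intro: ennreal_leI)
  qed simp
  then have "chi_square pt nu \<noteq> \<infinity>" "enn2real (chi_square pt nu) \<le> a * X"
    using a X0 by (auto simp: top_unique intro: enn2real_leI)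
  then have "chi pt nu \<le> ennreal (sqrt (a * X))"
    by (simp add: chi_def ennreal_leI)
  also have "sqrt a = exp (- \<delta> * t)"
    by (rule real_sqrt_unique) (auto simp: a_def power2_eq_square simp flip: exp_add)
  then have "sqrt (a * X) = exp (- \<delta> * t) * sqrt X"
    by (simp add: real_sqrt_mult)
  also have "ennreal (exp (- \<delta> * t) * sqrt X) = ennreal (exp (- \<delta> * t)) * chi p0 nu"
    using False X0 by (simp add: chi_def X_def ennreal_mult)
  finally show ?thesis by (simp add: pt_def)
qed

subsection \<open>The M/M/n queue\<close>

text \<open>The balance inequalities say that the flux \<open>J\<close> is nondecreasing in \<^term>\<open>i\<close>; being
  summable it vanishes.\<close>

lemma birth_death_detailed_balance:
  fixes nu :: "nat pmf"
  assumes P: "ctmc_transition (birth_death_rate b d) P" and nu: "stationary P nu"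
    and b: "\<And>i. 0 \<le> b i" "\<And>i. b i \<le> R" and d: "\<And>i. 0 \<le> d i"
  shows "pmf nu i * b i = pmf nu (Suc i) * d (Suc i)"
proof -
  define J where "J i = pmf nu i * b i - pmf nu (Suc i) * d (Suc i)" for i
  have J0: "0 \<le> J 0"
    using stationary_balance_le[OF P nu, of "{0, 1}" 0] by (simp add: J_def birth_death_rate_def)
  have J_Suc: "J i \<le> J (Suc i)" for i
    using stationary_balance_le[OF P nu, of "{i, Suc i, Suc (Suc i)}" "Suc i"]
    by (simp add: J_def birth_death_rate_def algebra_simps)
  have nonneg: "0 \<le> J i" for i
    using J0 J_Suc by (induction i) (auto intro: order_trans)
  have nu0: "pmf nu \<longlonglongrightarrow> 0" using sums_pmf sums_summable summable_LIMSEQ_zero by blast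
  have "(\<lambda>i. pmf nu i * b i) \<longlonglongrightarrow> 0"
  proof (rule tendsto_sandwich[of "\<lambda>_. 0" _ _ "\<lambda>i. pmf nu i * R"])
    show "(\<lambda>i. pmf nu i * R) \<longlonglongrightarrow> 0" using tendsto_mult_right[OF nu0, of R] by simp
  qed (auto intro!: always_eventually mult_left_mono simp: b)
  moreover have "J k \<le> pmf nu k * b k" for k using d by (simp add: J_def)
  moreover have "J i \<le> J k" if "i \<le> k" for k using J_Suc that by (rule lift_Suc_mono_le)
  ultimately have "J i \<le> 0"
    by (intro tendsto_lowerbound[of _ 0 sequentially]) (auto intro!: eventually_sequentiallyI[of i] intro: order_trans)
  with nonneg[of i] show ?thesis by (simp add: J_def)
qed

text \<open>By detailed balance a zero at state 0 would spread to all states, contradicting total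
  mass 1.\<close>

lemma birth_death_stationary_pos:
  fixes nu :: "nat pmf"
  assumes rev: "\<And>i. pmf nu i * b i = pmf nu (Suc i) * d (Suc i)"
    and b: "\<And>i. 0 < b i" and d: "\<And>i. 0 < d (Suc i)"
  shows "0 < pmf nu i"
proof -
  have eq: "pmf nu (Suc i) = pmf nu i * b i / d (Suc i)" for i using rev[of i] d[of i] by (simp add: field_simps)
  have "0 < pmf nu 0"
  proof (rule ccontr)
    assume "\<not> 0 < pmf nu 0"
    then have "pmf nu 0 = 0" using pmf_nonneg[of nu 0] by linarith
    then have "pmf nu i = 0" for i by (induction i) (simp_all add: eq)
    then have "pmf nu = (\<lambda>_. 0)" by (rule ext)
    then have "pmf nu sums 0" by simp
    with sums_pmf[of nu] show False using sums_unique2 by fastforce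
  qed
  then show ?thesis by (induction i) (simp_all add: eq b d)
qed

text \<open>The two upper bounds on \<open>\<delta>\<close> are what Chen's criterion yields in the
  states below \<open>n\<close> and in those from \<open>n\<close> on, respectively.\<close>

lemma mmn_chi_contraction:
  fixes n l :: nat and \<eta> \<delta> :: real
  assumes l: "0 < l" "Suc l < n" and \<eta>: "0 < \<eta>" "\<eta> < 1"
    and \<delta>: "0 < \<delta>" "\<delta> \<le> 1 - \<eta>" "\<delta> \<le> \<eta> * (1 - \<eta>) * (real (n - l) * (real (n - l) - 1) / real n)"
    and P: "ctmc_transition (mmn_rate n (real l)) P" and nu: "stationary P nu" and t: "0 \<le> t"
  shows "chi (law_at P p0 t) nu \<le> ennreal (exp (- \<delta> * t)) * chi p0 nu"
proof -
  define b where "b i = real l" for i :: nat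
  define d where "d i = real (min n i)" for i
  define R where "R = real n"
  have P': "ctmc_transition (birth_death_rate b d) P"
    using P by (simp add: mmn_rate_def b_def[abs_def] d_def[abs_def])
  have b: "0 < b i" "0 \<le> b i" "b i \<le> R" and d: "0 \<le> d i" "d i \<le> R" "0 < d (Suc i)" for i
    using l by (auto simp: b_def d_def R_def)
  note rev = birth_death_detailed_balance[OF P' nu b(2,3) d(1)]
  note pos = birth_death_stationary_pos[OF rev b(1) d(3)]
  \<comment> \<open>The extra 1 makes the bound on the exit rates strict.\<close>
  have L: "- (real l + real n + 1) < birth_death_rate b d i i" for i
    by (auto simp: birth_death_rate_def b_def d_def)
  \<comment> \<open>\<^term>\<open>1 + w i\<close> is the ratio of consecutive increments of a test function that grows linearly up
    to \<^term>\<open>l\<close> and ever faster from there to \<^term>\<open>n\<close>; truncated subtraction makes \<^term>\<open>w i = 0\<close> for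
    \<^term>\<open>i \<le> l\<close>.\<close>
  define w where "w i = \<eta> * real (min i (n - 1) - l) / real l" for i
  define c where "c i = (if i = 0 then 0 else d i / (real l * (1 + w (i - 1))))" for i
  have w: "0 \<le> w i" for i using \<eta> by (simp add: w_def)
  have lw: "real l * (1 + w i) = real l + \<eta> * real (min i (n - 1) - l)" for i
    using l by (simp add: w_def field_simps)
  have lw_pos: "0 < real l * (1 + w i)" for i using w[of i] l by simp
  have c_pos: "0 < c (Suc i)" for i using lw_pos[of i] d(3)[of i] by (simp add: c_def)
  have c_le: "c i \<le> R / real l" for i
  proof -
    have "d i / (real l * (1 + w (i - 1))) \<le> R / real l"
      using w[of "i - 1"] l d[of i] by (intro frac_le) auto
    then show ?thesis by (auto simp: c_def R_def)
  qed
  have gap: "\<delta> \<le> b i * (1 - c i) + d (Suc i) * (1 - 1 / c (Suc i))" for i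
  proof -
    \<comment> \<open>With these weights the criterion asks that
      \<open>d (Suc i) - l * (1 + w i) + l - d i / (1 + w (i - 1))\<close> be at least
      \<open>\<delta>\<close>, the last quotient being 0 for \<open>i = 0\<close>.\<close>
    have 1: "d (Suc i) * (1 - 1 / c (Suc i)) = d (Suc i) - real l * (1 + w i)"
      using d(3)[of i] lw_pos[of i] by (simp add: c_def field_simps)
    have 2: "b i * (1 - c i) = real l - (if i = 0 then 0 else d i / (1 + w (i - 1)))"
      using l by (simp add: c_def b_def right_diff_distrib)
    show ?thesis
    proof (cases "i < n")
      case True
      \<comment> \<open>The gain from \<open>d (Suc i)\<close> is \<open>i + 1\<close>, so this
        leaves \<open>1 - \<eta>\<close>. Above \<open>l\<close> the lost \<open>\<eta>\<close> is
        the shift between \<open>w (i - 1)\<close>, with numerator \<open>\<eta> * j\<close>, and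
        \<open>w i\<close>, with \<open>\<eta> * (j + 1)\<close>.\<close>
      have "(if i = 0 then 0 else d i / (1 + w (i - 1))) + \<eta> * real (min i (n - 1) - l) \<le> real i + \<eta>"
      proof (cases "i \<le> l")
        case False
        define j where "j = real i - 1 - real l"
        have j: "0 \<le> j" using False by (simp add: j_def)
        have wj: "w (i - 1) = \<eta> * j / real l" and di: "d i = real i"
          using False True l by (auto simp: w_def j_def d_def of_nat_diff min_def)
        have *: "real l + \<eta> * j \<le> real i" using j \<eta> mult_right_mono[of \<eta> 1 j] by (simp add: j_def)
        have "real i * real l \<le> (real i - \<eta> * j) * (real l + \<eta> * j)"
        proof -
          have "(real i - \<eta> * j) * (real l + \<eta> * j) - real i * real l = \<eta> * j * (real i - (real l + \<eta> * j))"
            by algebra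
          also have "\<dots> \<ge> 0" using * j \<eta> by simp
          finally show ?thesis by simp
        qed
        moreover have lj: "0 < real l + \<eta> * j" using l j \<eta> by (simp add: add_pos_nonneg)
        ultimately have "real i * real l / (real l + \<eta> * j) \<le> real i - \<eta> * j"
          by (simp add: pos_divide_le_eq)
        also have "real i * real l / (real l + \<eta> * j) = real i / (1 + w (i - 1))"
          unfolding wj using l lj by (simp add: field_simps)
        finally have "real i / (1 + w (i - 1)) \<le> real i - \<eta> * j" .
        moreover have "real (min i (n - 1) - l) = j + 1"
          using False True by (simp add: j_def of_nat_diff min_def)
        ultimately show ?thesis using False by (simp add: di algebra_simps)
      qed (use \<eta> True in \<open>auto simp: d_def w_def min_def\<close>)
      then show ?thesis
        using True \<delta> unfolding 1 2 lw by (simp add: d_def)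
    next
      case False
      define m where "m = real (n - l)"
      have m: "2 \<le> m" "real n = real l + m" using l by (auto simp: m_def of_nat_diff)
      \<comment> \<open>Freezing \<open>w\<close> already at \<open>n - 1\<close> makes it agree at
        \<open>i - 1\<close> and \<open>i\<close> for all \<open>i \<ge> n\<close>; this is where
        \<open>m - 1\<close> in the bound on \<open>\<delta>\<close> comes from.\<close>
      have wi: "w i = \<eta> * (m - 1) / real l" "w (i - 1) = w i"
        using False l by (auto simp: w_def m_def of_nat_diff min_def)
      define x where "x = \<eta> * (m - 1)"
      have x: "0 \<le> x" "x \<le> \<eta> * m" using \<eta> m by (auto simp: x_def)
      have xm: "x \<le> m" using order_trans[OF x(2) mult_left_le_one_le[of m \<eta>]] \<eta> m by simp
      have lw': "real l * (1 + w i) = real l + x" using l by (simp add: wi x_def field_simps)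
      \<comment> \<open>From \<open>n\<close> on the criterion simplifies to
        \<open>x * (m - x) / (l + x)\<close>, which is bounded below through
        \<open>x \<le> \<eta> * m\<close> and \<open>l + x \<le> n\<close>.\<close>
      have "\<delta> \<le> x * (m - \<eta> * m) / real n"
        using \<delta>(3) by (simp add: x_def m_def algebra_simps)
      also have "\<dots> \<le> x * (m - x) / (real l + x)"
        using x xm l \<eta> m by (intro frac_le mult_mono) auto
      also have "\<dots> = real l - real n / (1 + w i) + (real n - real l * (1 + w i))"
      proof -
        have "real n / (1 + w i) = real n * real l / (real l + x)"
          unfolding lw'[symmetric] using l by simp
        then show ?thesis unfolding lw' m(2) using x l by (simp add: field_simps)
      qed
      finally show ?thesis using False l unfolding 1 2 wi(2) by (simp add: d_def)
    qed
  qed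
  \<comment> \<open>From \<open>n\<close> on all servers are busy and the stationary law is
    geometric with ratio \<open>l / n\<close>.\<close>
  have tail: "pmf nu (Suc i) \<le> real l / real n * pmf nu i" if "n \<le> i" for i
    using rev[of i] that l by (simp add: b_def d_def field_simps)
  have poincare: "\<delta> * measure_pmf.expectation nu (\<lambda>x. (g x)\<^sup>2)
      \<le> measure_pmf.expectation nu (\<lambda>x. b x * (g (Suc x) - g x)\<^sup>2)"
    if "\<And>x. \<bar>g x\<bar> \<le> B" "measure_pmf.expectation nu g = 0" for g B
    by (rule birth_death_poincare[OF pos rev b(1,3) _ c_pos c_le \<delta>(1) gap _ _ tail that])
       (use l in \<open>auto simp: c_def\<close>)
  show ?thesis
    by (rule chi_contraction[OF nu pos t])
       (rule transition_norm_contraction[OF P' nu b(2,3) d(1,2) rev L poincare t])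
qed

section \<open>Choice of the rate and its limit\<close>

theorem proposition5:
  fixes \<alpha> :: real and lam :: "nat \<Rightarrow> int"
  assumes "\<alpha> < 1 / 2"
    and "\<And>n. n \<ge> 3 \<Longrightarrow> lam n \<ge> 0"
    and "\<And>n. n \<ge> 3 \<Longrightarrow> int n - lam n \<ge> 1"
    and "\<And>n. n \<ge> 3 \<Longrightarrow> ln (real n - real_of_int (lam n)) / ln (real n) \<in> {1 / 2<..<1}"
    and "(\<lambda>n. ln (real n - real_of_int (lam n)) / ln (real n)) \<longlonglongrightarrow> 1 - \<alpha>"
  shows "\<exists>D :: nat \<Rightarrow> real.
           (\<forall>n\<ge>3. D n > 0) \<and> D \<longlonglongrightarrow> 1 \<and>
           (\<forall>n\<ge>3. \<forall>P nu. ctmc_transition (mmn_rate n (real_of_int (lam n))) P \<and> stationary P nu \<longrightarrow>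
              (\<forall>p0 :: nat pmf. \<forall>t\<ge>0.
                 chi (law_at P p0 t) nu \<le> ennreal (exp (- D n * t)) * chi p0 nu))"
proof -
  define m where "m n = real n - real_of_int (lam n)" for n
  define r where "r n = m n * (m n - 1) / real n" for n
  define D where "D n = (r n / (1 + r n))\<^sup>2" for n
  have m1: "1 \<le> m n" if "3 \<le> n" for n using assms(3)[OF that] by (simp add: m_def)
  \<comment> \<open>The strict bounds on the quotient of logarithms give \<open>1 < m n < n\<close>;
    by integrality this provides \<open>0 < l\<close> and \<open>Suc l < n\<close> for every
    \<open>n \<ge> 3\<close>, not only for large \<open>n\<close>.\<close>
  have m_gt: "1 < m n" and m_lt: "m n < real n" if n: "3 \<le> n" for n
  proof -
    have "0 < ln (real n)" using n by simp
    with assms(4)[OF n] have "0 < ln (m n)" "ln (m n) < ln (real n)"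
      by (auto simp: m_def field_simps)
    then show "1 < m n" "m n < real n" using m1[OF n] n by auto
  qed
  have r_pos: "0 < r n" if "3 \<le> n" for n
    using m_gt[OF that] that by (simp add: r_def)
  have D_pos: "0 < D n" if "3 \<le> n" for n
    using r_pos[OF that] by (simp add: D_def add_pos_pos)
  \<comment> \<open>Any exponent strictly between \<open>1 / 2\<close> and
    \<open>1 - \<alpha>\<close> serves: then \<open>r n\<close> is at least of order
    \<open>n powr (2 * s - 1)\<close>, which is unbounded.\<close>
  define s where "s = (1 / 2 + (1 - \<alpha>)) / 2"
  have s: "1 / 2 < s" "s < 1 - \<alpha>" using assms(1) by (auto simp: s_def)
  have "\<forall>\<^sub>F n in sequentially. s < ln (m n) / ln (real n)"
    using assms(5) s(2) unfolding m_def by (rule order_tendstoD)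
  then have "\<forall>\<^sub>F n in sequentially. (real n powr s) * (real n powr s - 1) / real n \<le> r n"
    using eventually_ge_at_top[of 3]
  proof eventually_elim
    case (elim n)
    then have "s * ln (real n) < ln (m n)" by (simp add: field_simps)
    then have "real n powr s \<le> m n"
      using elim m1[of n] by (simp add: powr_def flip: ln_ge_iff)
    moreover have "1 \<le> real n powr s" using elim s by (intro ge_one_powr_ge_zero) auto
    ultimately show ?case unfolding r_def
      using elim by (intro divide_right_mono mult_mono) auto
  qed
  moreover have "filterlim (\<lambda>n. (real n powr s) * (real n powr s - 1) / real n) at_top sequentially"
    using s by real_asymp
  ultimately have r_lim: "filterlim r at_top sequentially"
    by (rule filterlim_at_top_mono[rotated])
  have "((\<lambda>x::real. (x / (1 + x))\<^sup>2) \<longlongrightarrow> 1) at_top" by real_asymp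
  from filterlim_compose[OF this r_lim] have D_lim: "D \<longlonglongrightarrow> 1" by (simp add: D_def[abs_def])
  have contr: "chi (law_at P p0 t) nu \<le> ennreal (exp (- D n * t)) * chi p0 nu"
    if n: "3 \<le> n" and P: "ctmc_transition (mmn_rate n (real_of_int (lam n))) P" and nu: "stationary P nu"
      and t: "0 \<le> t" for n P nu p0 t
  proof -
    define l where "l = nat (lam n)"
    have l: "real l = real_of_int (lam n)" "int l = lam n" using assms(2)[OF n] by (simp_all add: l_def)
    have l2: "0 < l" "Suc l < n" using m_gt[OF n] m_lt[OF n] unfolding m_def l(1)[symmetric] by linarith+
    have ml: "real (n - l) = m n" using l2 l by (simp add: m_def of_nat_diff)
    \<comment> \<open>This is the solution of \<open>\<eta> * r n = 1 - \<eta>\<close>, so that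
      \<open>\<eta> * (1 - \<eta>) * r n\<close> is exactly \<open>D n\<close>, the square of
      \<open>1 - \<eta>\<close>.\<close>
    define \<eta> where "\<eta> = 1 / (1 + r n)"
    have r: "0 < r n" by (rule r_pos[OF n])
    have \<eta>: "0 < \<eta>" "\<eta> < 1" "1 - \<eta> = r n / (1 + r n)" using r by (auto simp: \<eta>_def field_simps)
    have "D n \<le> 1 - \<eta>"
      unfolding D_def \<eta>(3) power2_eq_square using r by (intro mult_left_le_one_le) (auto simp: field_simps)
    moreover have "D n \<le> \<eta> * (1 - \<eta>) * (real (n - l) * (real (n - l) - 1) / real n)"
      unfolding ml r_def[symmetric] \<eta>(3) by (simp add: D_def \<eta>_def power2_eq_square)
    ultimately show ?thesis
      using mmn_chi_contraction[OF l2 \<eta>(1,2) D_pos[OF n] _ _ _ nu t] P l by simp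
  qed
  show ?thesis using D_pos D_lim contr by (intro exI[of _ D]) auto
qed

end
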